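(* (Infallibility) Assume $\lim_{n\to\infty}\rho_n=0$. If the sequence $(\gamma_n/\rho_n)_{n\ge1}$ is bounded, $\sum_n\gamma_n\rho_n=\infty$, and $\pi=p_A-p_B>0$, then $\lim_{n\to\infty}X_n=1$ almost surely.
   Context: Let $0<p_B\le p_A<1$ and $\pi=p_A-p_B$. Let $(\gamma_n)_{n\ge 1}$ be a non-increasing sequence of positive numbers with $\gamma_n<1$, $\sum_{n\ge 1}\gamma_n=+\infty$ and $\sum_{n}e^{-\vartheta/\gamma_n}<\infty$ for every $\vartheta>0$. Let $(\rho_n)_{n\ge 1}$ be a sequence of positive numbers with $\gamma_n\rho_n<1$. Let $(U_n)_{n\ge 1}$ be i.i.d. random variables uniformly distributed on $[0,1]$, and let $A_n,B_n$ ($n\ge1$) be events with $\mathbb{P}(A_n)=p_A$, $\mathbb{P}(B_n)=p_B$, such that the pairs $(\mathbf 1_{A_n},\mathbf 1_{B_n})$, $n\ge 1$, are independent of one another and the sequence $(\mathbf 1_{A_n},\mathbf 1_{B_n})_{n\ge1}$ is independent of $(U_n)_{n\ge1}$. The penalized two-armed bandit algorithm is the $[0,1]$-valued sequence $(X_n)_{n\ge0}$ with $X_0=x\in(0,1)$ and $$X_{n+1}=X_n+\gamma_{n+1}\left(\mathbf 1_{\{U_{n+1}\le X_n\}\cap A_{n+1}}(1-X_n)-\mathbf 1_{\{U_{n+1}>X_n\}\cap B_{n+1}}X_n\right)-\gamma_{n+1}\rho_{n+1}\left(X_n\mathbf 1_{\{U_{n+1}\le X_n\}\cap A_{n+1}^c}-(1-X_n)\mathbf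 1_{\{U_{n+1}>X_n\}\cap B_{n+1}^c}\right),\quad n\ge0.$$ *)

theory Defs
  imports "HOL-Probability.Probability"
begin

text \<open>
  The library's \<open>indep_var\<close> forces both random variables to have the same value type. This
  is the same notion (independence of the generated sigma-algebras) for two value types; the two
  agree whenever the library's notion is typeable.
\<close>

definition (in prob_space) indep_var_het ::
  "'b measure \<Rightarrow> ('a \<Rightarrow> 'b) \<Rightarrow> 'c measure \<Rightarrow> ('a \<Rightarrow> 'c) \<Rightarrow> bool"
where
  "indep_var_het S X T Y \<longleftrightarrow>
     random_variable S X \<and> random_variable T Y \<and>
     indep_set (sigma_sets (space M) {X -` C \<inter> space M | C. C \<in> sets S})
               (sigma_sets (space M) {Y -` C \<inter> space M | C. C \<in> sets T})"

lemma (in prob_space) indep_var_het_iff_indep_var: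
  "indep_var_het S X T Y \<longleftrightarrow> indep_var S X T Y"
  by (auto simp: indep_var_het_def indep_var_eq)

text \<open>
  The sequences \<open>\<gamma>\<close>, \<open>\<rho>\<close>, \<open>U\<close>, \<open>A\<close>, \<open>B\<close> are indexed from 1; their values at 0 are
  never used. Complements are taken in the whole type, which agrees with complements in the
  probability space at every sample point \<open>\<omega>\<close> of that space.
\<close>

primrec penalized_bandit ::
  "(nat \<Rightarrow> real) \<Rightarrow> (nat \<Rightarrow> real) \<Rightarrow> (nat \<Rightarrow> 'a \<Rightarrow> real) \<Rightarrow> (nat \<Rightarrow> 'a set) \<Rightarrow> (nat \<Rightarrow> 'a set)
    \<Rightarrow> real \<Rightarrow> nat \<Rightarrow> 'a \<Rightarrow> real"
where
  "penalized_bandit \<gamma> \<rho> U A B x 0 = (\<lambda>\<omega>. x)"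
| "penalized_bandit \<gamma> \<rho> U A B x (Suc n) =
    (let X = penalized_bandit \<gamma> \<rho> U A B x n;
         playA = {\<omega>. U (Suc n) \<omega> \<le> X \<omega>};
         playB = {\<omega>. U (Suc n) \<omega> > X \<omega>}
     in (\<lambda>\<omega>. X \<omega>
          + \<gamma> (Suc n) * (indicator (playA \<inter> A (Suc n)) \<omega> * (1 - X \<omega>)
                         - indicator (playB \<inter> B (Suc n)) \<omega> * X \<omega>)
          - \<gamma> (Suc n) * \<rho> (Suc n) * (X \<omega> * indicator (playA \<inter> - A (Suc n)) \<omega>
                         - (1 - X \<omega>) * indicator (playB \<inter> - B (Suc n)) \<omega>)))"

lemma penalized_bandit_in_unit_interval:
  assumes "x \<in> {0..1}"
    and "\<And>n. n \<ge> 1 \<Longrightarrow> 0 \<le> \<gamma> n \<and> \<gamma> n \<le> 1"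
    and "\<And>n. n \<ge> 1 \<Longrightarrow> 0 \<le> \<gamma> n * \<rho> n \<and> \<gamma> n * \<rho> n \<le> 1"
  shows "penalized_bandit \<gamma> \<rho> U A B x n \<omega> \<in> {0..1}"
proof (induction n)
  case 0
  then show ?case using assms(1) by simp
next
  case (Suc n)
  define y where "y = penalized_bandit \<gamma> \<rho> U A B x n \<omega>"
  define g where "g = \<gamma> (Suc n)"
  define h where "h = \<gamma> (Suc n) * \<rho> (Suc n)"
  have y: "0 \<le> y" "y \<le> 1" using Suc by (auto simp: y_def)
  have g: "0 \<le> g" "g \<le> 1" and h: "0 \<le> h" "h \<le> 1"
    using assms(2,3)[of "Suc n"] by (auto simp: g_def h_def)
  have up: "0 \<le> y + c * (1 - y) \<and> y + c * (1 - y) \<le> 1"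
    and down: "0 \<le> y - c * y \<and> y - c * y \<le> 1" if c: "0 \<le> c" "c \<le> 1" for c
  proof -
    have "c * (1 - y) \<le> 1 - y" "0 \<le> c * (1 - y)" "c * y \<le> y" "0 \<le> c * y"
      using c y by (auto intro: mult_left_le_one_le)
    then show "0 \<le> y + c * (1 - y) \<and> y + c * (1 - y) \<le> 1" "0 \<le> y - c * y \<and> y - c * y \<le> 1"
      using y by linarith+
  qed
  show ?case
    using up[OF g] down[OF g] up[OF h] down[OF h]
    by (simp add: Let_def indicator_def y_def[symmetric] g_def h_def algebra_simps)
qed

end

theory Submission
  imports Defs
begin

text \<open>
  Two arms are played; the better one succeeds with probability \<open>p\<close>, the other one with
  probability \<open>q < p\<close>, and \<open>X\<^sub>n\<close> is the probability of choosing the better one. Up to the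
  factor \<open>\<gamma>\<^sub>n\<^sub>+\<^sub>1\<close>, the conditional mean of the increment at the point \<open>x\<close> is the sum of the
  reward part \<open>(p - q) x (1 - x)\<close> and of \<open>\<rho>\<^sub>n\<^sub>+\<^sub>1\<close> times the penalty part
  \<open>(1 - q) (1 - x)\<^sup>2 - (1 - p) x\<^sup>2\<close>. Two consequences are combined for a small level \<open>d\<close>, once
  the penalty rate \<open>\<rho>\<close> is small compared to \<open>d\<close>.

  First, the process returns to \<open>[1 - d, 1]\<close> over and over again (\<open>returns_near_1\<close>). On all
  of \<open>[0, 1 - d]\<close> the conditional mean increment is at least a constant times \<open>\<gamma>\<^sub>n\<^sub>+\<^sub>1 \<rho>\<^sub>n\<^sub>+\<^sub>1\<close>:
  near 0 this is due to the penalty, elsewhere to the reward. A bounded process cannot keep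
  growing in mean at such a rate, since \<open>\<Sum> \<gamma>\<^sub>n \<rho>\<^sub>n\<close> diverges.

  Second, only finitely often does the process travel from \<open>[1 - d, 1]\<close> down to \<open>1 - 2 d\<close>
  (\<open>prob_excursion_le\<close>). Between the two levels the conditional mean increment is at least a
  positive constant times \<open>\<gamma>\<^sub>n\<^sub>+\<^sub>1\<close>, and the jumps are at most \<open>\<gamma>\<^sub>n\<^sub>+\<^sub>1\<close>. Hence
  \<open>exp (\<theta> (1 - X\<^sub>n) / \<gamma>\<^sub>m\<^sub>+\<^sub>1)\<close> is a supermartingale along an excursion that leaves \<open>[1 - d, 1]\<close>
  after time \<open>m\<close>, provided that \<open>\<theta>\<close> is small, and such an excursion reaches \<open>1 - 2 d\<close> with
  probability at most \<open>exp \<theta> * exp (- \<theta> d / \<gamma>\<^sub>m\<^sub>+\<^sub>1)\<close>. These bounds are summable, and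
  Borel-Cantelli applies.

  Together, almost surely \<open>X\<^sub>n > 1 - 2 d\<close> for all large \<open>n\<close>, for every small \<open>d\<close>
  (\<open>eventually_near_1\<close>). The only probabilistic input is the formula for conditional
  expectations of functions of \<open>X\<^sub>n\<^sub>+\<^sub>1\<close> given the past (\<open>markov_step\<close>), which is derived from
  the independence hypotheses.
\<close>

section \<open>The transition operator and its drift\<close>

text \<open>
  The transition operator: the conditional expectation of \<open>f (X\<^sub>n\<^sub>+\<^sub>1)\<close> given \<open>X\<^sub>n = x\<close>, where
  \<open>g\<close> stands for the gain \<open>\<gamma>\<^sub>n\<^sub>+\<^sub>1\<close> and \<open>h\<close> for the penalty \<open>\<gamma>\<^sub>n\<^sub>+\<^sub>1 \<rho>\<^sub>n\<^sub>+\<^sub>1\<close>. The four terms are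
  success and failure of the first arm, played with probability \<open>x\<close>, and success and failure
  of the second.
\<close>

definition bandit_step ::
  "real \<Rightarrow> real \<Rightarrow> real \<Rightarrow> real \<Rightarrow> (real \<Rightarrow> real) \<Rightarrow> real \<Rightarrow> real"
where
  "bandit_step p q g h f x =
     x * (p * f (x + g * (1 - x)) + (1 - p) * f (x - h * x)) +
     (1 - x) * (q * f (x - g * x) + (1 - q) * f (x + h * (1 - x)))"

text \<open>
  The conditional mean increment divided by the gain, with \<open>r\<close> the penalty rate \<open>\<rho>\<^sub>n\<^sub>+\<^sub>1\<close>. The
  first summand is the reward part, which vanishes at both ends of the unit interval; the
  second one is the penalty part, which drives the process away from both ends if \<open>p\<close> and \<open>q\<close>
  are less than 1.
\<close>

definition bandit_drift :: "real \<Rightarrow> real \<Rightarrow> real \<Rightarrow> real \<Rightarrow> real" where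
  "bandit_drift p q r x =
     (p - q) * x * (1 - x) + r * ((1 - q) * (1 - x)\<^sup>2 - (1 - p) * x\<^sup>2)"

lemma bandit_step_affine:
  "bandit_step p q g (g * r) (\<lambda>z. a + b * z) x = a + b * (x + g * bandit_drift p q r x)"
  unfolding bandit_step_def bandit_drift_def by (simp add: algebra_simps power2_eq_square)

text \<open>
  The operator averages \<open>f\<close> over four points that lie in the unit interval and within one
  jump of \<open>x\<close>, so only the values at such points matter. Both the global bound and the local
  estimate of the exponential below rest on this.
\<close>

lemma bandit_step_mono:
  assumes p: "0 \<le> p" "p \<le> 1" and q: "0 \<le> q" "q \<le> 1"
    and g: "0 \<le> g" "g \<le> 1" and h: "0 \<le> h" "h \<le> 1" and x: "0 \<le> x" "x \<le> 1"
    and le: "\<And>z. 0 \<le> z \<Longrightarrow> z \<le> 1 \<Longrightarrow> \<bar>z - x\<bar> \<le> max g h \<Longrightarrow> f z \<le> f' z"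
  shows "bandit_step p q g h f x \<le> bandit_step p q g h f' x"
proof -
  have up: "f (x + c * (1 - x)) \<le> f' (x + c * (1 - x))"
    and down: "f (x - c * x) \<le> f' (x - c * x)"
    if c: "0 \<le> c" "c \<le> 1" "c \<le> max g h" for c
  proof -
    have "0 \<le> c * (1 - x)" "0 \<le> c * x"
      using c x by auto
    moreover have "c * (1 - x) \<le> c" "c * x \<le> c"
      using c x by (auto intro: mult_left_le)
    moreover have "c * (1 - x) \<le> 1 - x" "c * x \<le> x"
      using c x by (auto intro: mult_left_le_one_le)
    ultimately show "f (x + c * (1 - x)) \<le> f' (x + c * (1 - x))" "f (x - c * x) \<le> f' (x - c * x)"
      using c x by (intro le; linarith)+
  qed
  show ?thesis
    unfolding bandit_step_def using p q g h x
    by (intro add_mono mult_left_mono up down) auto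
qed

lemma bandit_step_const: "bandit_step p q g h (\<lambda>_. c) x = c"
  unfolding bandit_step_def by (simp add: algebra_simps)

lemma abs_bandit_step_le:
  assumes "0 \<le> p" "p \<le> 1" "0 \<le> q" "q \<le> 1" "0 \<le> g" "g \<le> 1" "0 \<le> h" "h \<le> 1" "0 \<le> x" "x \<le> 1"
    and f: "\<And>z. z \<in> {0..1} \<Longrightarrow> \<bar>f z\<bar> \<le> K"
  shows "\<bar>bandit_step p q g h f x\<bar> \<le> K"
proof -
  have f': "f z \<le> K" "- K \<le> f z" if "0 \<le> z" "z \<le> 1" for z
    using f[of z] that by auto
  have "bandit_step p q g h f x \<le> bandit_step p q g h (\<lambda>_. K) x"
       "bandit_step p q g h (\<lambda>_. - K) x \<le> bandit_step p q g h f x"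
    using assms f' by (auto intro!: bandit_step_mono)
  then show ?thesis by (simp add: bandit_step_const)
qed

text \<open>
  In the right half, but at distance \<open>d\<close> from 1, the reward part of the drift is at least
  \<open>(p - q) d / 2\<close>. The penalty part is at least \<open>- r\<close>, so a small penalty rate consumes at
  most half of it.
\<close>

lemma bandit_drift_ge_away_from_1:
  assumes p: "0 \<le> q" "q < p" "p \<le> 1" and d: "0 < d" "d \<le> 1" and r: "0 \<le> r" "r \<le> (p - q) * d / 4"
    and x: "1 / 2 \<le> x" "x \<le> 1 - d"
  shows "(p - q) * d / 4 \<le> bandit_drift p q r x"
proof -
  have "(p - q) * (d / 2) \<le> (p - q) * (x * (1 - x))"
  proof (intro mult_left_mono)
    have "1 / 2 * d \<le> x * (1 - x)"
      using x d by (intro mult_mono) auto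
    then show "d / 2 \<le> x * (1 - x)" by simp
  qed (use p in auto)
  moreover have "r * - 1 \<le> r * ((1 - q) * (1 - x)\<^sup>2 - (1 - p) * x\<^sup>2)"
  proof (intro mult_left_mono)
    have "(1 - p) * x\<^sup>2 \<le> 1 * 1"
      using p x d by (intro mult_mono) (auto intro: power_le_one)
    moreover have "0 \<le> (1 - q) * (1 - x)\<^sup>2"
      using p by simp
    ultimately show "- 1 \<le> (1 - q) * (1 - x)\<^sup>2 - (1 - p) * x\<^sup>2" by linarith
  qed (use r in auto)
  ultimately show ?thesis
    using r unfolding bandit_drift_def mult.assoc by linarith
qed

text \<open>
  The reward part vanishes at 0, so it has no positive lower bound on the left half. There
  the penalty takes over: on the left half \<open>1 - x \<ge> x\<close>, and the worse arm fails more often, so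
  the penalty part pushes towards 1 at a rate proportional to \<open>r\<close>.
\<close>

lemma bandit_drift_ge_penalty:
  assumes p: "0 \<le> q" "q < p" "p \<le> 1" and d: "0 < d" "d \<le> 1" and r: "0 \<le> r" "r \<le> (p - q) * d / 4"
    and x: "0 \<le> x" "x \<le> 1 - d"
  shows "r * ((p - q) / 4) \<le> bandit_drift p q r x"
proof (cases "x \<le> 1 / 2")
  case True
  have "(p - q) / 4 \<le> (1 - q) * (1 - x)\<^sup>2 - (1 - p) * x\<^sup>2"
  proof -
    have "(1 - p) * x\<^sup>2 \<le> (1 - p) * (1 - x)\<^sup>2"
      using p x True by (intro mult_left_mono power_mono) auto
    moreover have "(p - q) * (1 / 2)\<^sup>2 \<le> (p - q) * (1 - x)\<^sup>2"
      using p True by (intro mult_left_mono power_mono) auto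
    ultimately show ?thesis
      by (simp add: algebra_simps power2_eq_square)
  qed
  then have "r * ((p - q) / 4) \<le> r * ((1 - q) * (1 - x)\<^sup>2 - (1 - p) * x\<^sup>2)"
    using r by (intro mult_left_mono) auto
  moreover have "0 \<le> (p - q) * x * (1 - x)"
    using p x d by auto
  ultimately show ?thesis
    unfolding bandit_drift_def by linarith
next
  case False
  have "r * ((p - q) / 4) \<le> r * 1"
    using r p by (intro mult_left_mono) auto
  also have "\<dots> \<le> bandit_drift p q r x"
    using bandit_drift_ge_away_from_1[OF p d r, of x] False x r by simp
  finally show ?thesis .
qed

lemma exp_le_quadratic:
  fixes u :: real
  assumes "\<bar>u\<bar> \<le> 1"
  shows "exp u \<le> 1 + u + u\<^sup>2"
proof (cases "0 \<le> u")
  case True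
  then show ?thesis using exp_bound[of u] assms by simp
next
  case False
  then have u: "u < 0" by simp
  have "(1 + u + u\<^sup>2) * (1 - u) = 1 - u * u\<^sup>2"
    by (simp add: algebra_simps power2_eq_square)
  also have "\<dots> \<ge> 1"
    using u by (simp add: mult_nonpos_nonneg)
  finally have "1 / (1 - u) \<le> 1 + u + u\<^sup>2"
    using u by (simp add: divide_simps)
  moreover have "1 - u \<le> exp (- u)"
    using exp_ge_add_one_self[of "- u"] by simp
  then have "exp u \<le> 1 / (1 - u)"
    using u by (simp add: exp_minus divide_simps mult.commute)
  ultimately show ?thesis by linarith
qed

text \<open>
  Second-order effects of the jumps, of relative size \<open>(l g)\<^sup>2\<close>, are dominated by the
  first-order gain \<open>l g\<close> times the drift as soon as \<open>l g\<close> does not exceed the drift. Hence \<open>l\<close>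
  may be as large as a small constant divided by \<open>g\<close>, which makes the resulting tail bounds
  exponential in \<open>1 / g\<close>.
\<close>

lemma bandit_step_exp_le:
  assumes p: "0 \<le> p" "p \<le> 1" and q: "0 \<le> q" "q \<le> 1" and x: "0 \<le> x" "x \<le> 1"
    and g: "0 \<le> g" "g \<le> 1" and r: "0 \<le> r" "r \<le> 1"
    and l: "0 \<le> l" "l * g \<le> 1" "l * g \<le> bandit_drift p q r x"
  shows "bandit_step p q g (g * r) (\<lambda>z. exp (l * (1 - z))) x \<le> exp (l * (1 - x))"
proof -
  let ?E = "exp (l * (1 - x))"
  have gr: "g * r \<le> g" using g r by (simp add: mult_left_le)
  \<comment> \<open>Replacing the exponential by an affine majorant on the jump range reduces the step to
  the mean increment.\<close>
  have "bandit_step p q g (g * r) (\<lambda>z. exp (l * (1 - z))) x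
      \<le> bandit_step p q g (g * r) (\<lambda>z. ?E * (1 + l * x + (l * g)\<^sup>2) + (- ?E * l) * z) x"
  proof (intro bandit_step_mono)
    fix z assume "\<bar>z - x\<bar> \<le> max g (g * r)"
    then have "\<bar>z - x\<bar> \<le> g" using gr by simp
    then have *: "\<bar>l * (x - z)\<bar> \<le> l * g"
      using l(1) by (simp add: abs_mult abs_minus_commute mult_left_mono)
    have "exp (l * (1 - z)) = ?E * exp (l * (x - z))"
      by (simp add: mult_exp_exp algebra_simps)
    also have "exp (l * (x - z)) \<le> 1 + l * (x - z) + (l * (x - z))\<^sup>2"
      using * l by (intro exp_le_quadratic) auto
    also have "(l * (x - z))\<^sup>2 \<le> (l * g)\<^sup>2"
      using power_mono[OF *, of 2] by simp
    finally show "exp (l * (1 - z)) \<le> ?E * (1 + l * x + (l * g)\<^sup>2) + (- ?E * l) * z"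
      by (simp add: algebra_simps)
  qed (use assms gr in auto)
  also have "\<dots> = ?E * (1 + (l * g) * (l * g - bandit_drift p q r x))"
    unfolding bandit_step_affine by (simp add: algebra_simps power2_eq_square)
  also have "\<dots> \<le> ?E * 1"
    using l g by (intro mult_left_mono) (auto simp: mult_nonneg_nonpos)
  finally show ?thesis by simp
qed


section \<open>Convergence of chains with this transition operator\<close>

text \<open>
  Everything about the convergence follows from the averaging identity \<open>step\<close>, a form of the
  Markov property that mentions neither the uniform variables nor the arms.
\<close>

locale bandit_chain = prob_space M for M :: "'a measure" +
  fixes F :: "nat \<Rightarrow> 'a measure" and X :: "nat \<Rightarrow> 'a \<Rightarrow> real"
    and \<gamma> \<rho> :: "nat \<Rightarrow> real" and p q :: real
  assumes F_sub: "\<And>n. subalgebra M (F n)"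
    and F_mono: "\<And>m n. m \<le> n \<Longrightarrow> subalgebra (F n) (F m)"
    and X_adapted: "\<And>n. X n \<in> borel_measurable (F n)"
    and X_range: "\<And>n \<omega>. X n \<omega> \<in> {0..1}"
    and p_range: "0 \<le> q" "q < p" "p \<le> 1"
    and gain: "\<And>n. n \<ge> 1 \<Longrightarrow> 0 < \<gamma> n" "\<And>n. n \<ge> 1 \<Longrightarrow> \<gamma> n < 1"
    and penalty: "\<And>n. n \<ge> 1 \<Longrightarrow> 0 < \<rho> n" "\<And>n. n \<ge> 1 \<Longrightarrow> \<gamma> n * \<rho> n < 1"
    and step: "\<And>n D f K. D \<in> sets (F n) \<Longrightarrow> f \<in> borel_measurable borel \<Longrightarrow>
        (\<And>z. z \<in> {0..1} \<Longrightarrow> \<bar>f z\<bar> \<le> K) \<Longrightarrow>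
        (\<integral>\<omega>. indicator D \<omega> * f (X (Suc n) \<omega>) \<partial>M) =
        (\<integral>\<omega>. indicator D \<omega> *
            bandit_step p q (\<gamma> (Suc n)) (\<gamma> (Suc n) * \<rho> (Suc n)) f (X n \<omega>) \<partial>M)"
begin

lemma X_01: "0 \<le> X n \<omega>" "X n \<omega> \<le> 1"
  using X_range[of n \<omega>] by auto

lemma space_F: "space (F n) = space M"
  using F_sub[of n] by (simp add: subalgebra_def)

lemma sets_F_M: "D \<in> sets (F n) \<Longrightarrow> D \<in> sets M"
  using F_sub[of n] by (auto simp: subalgebra_def)

lemma X_meas_F: "m \<le> n \<Longrightarrow> X m \<in> borel_measurable (F n)"
  using measurable_from_subalg[OF F_mono X_adapted] .

lemma X_meas [measurable]: "X n \<in> borel_measurable M"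
  using measurable_from_subalg[OF F_sub X_adapted] .

lemma integrable_on_event:
  assumes D: "D \<in> sets M" and f: "f \<in> borel_measurable borel"
    and K: "\<And>z. z \<in> {0..1} \<Longrightarrow> \<bar>f z :: real\<bar> \<le> K"
  shows "integrable M (\<lambda>\<omega>. indicator D \<omega> * f (X n \<omega>))"
proof (rule integrable_const_bound[where B = "\<bar>K\<bar>"])
  show "AE \<omega> in M. norm (indicator D \<omega> * f (X n \<omega>)) \<le> \<bar>K\<bar>"
    using order_trans[OF K[OF X_range] abs_ge_self] by (auto simp: indicator_def)
qed (use D f in measurable)

lemma integrable_event_indicator: "D \<in> sets M \<Longrightarrow> integrable M (indicator D :: 'a \<Rightarrow> real)"
  by (simp add: emeasure_eq_measure)

text \<open>
  The form in which the averaging identity is used: a pointwise bound on the transition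
  operator along a past event gives a supermartingale-type inequality restricted to that
  event.
\<close>

lemma step_le:
  assumes D: "D \<in> sets (F n)"
    and f: "f \<in> borel_measurable borel" "\<And>z. z \<in> {0..1} \<Longrightarrow> \<bar>f z\<bar> \<le> K"
    and f': "f' \<in> borel_measurable borel" "\<And>z. z \<in> {0..1} \<Longrightarrow> \<bar>f' z\<bar> \<le> K'"
    and le: "\<And>\<omega>. \<omega> \<in> D \<Longrightarrow>
        bandit_step p q (\<gamma> (Suc n)) (\<gamma> (Suc n) * \<rho> (Suc n)) f (X n \<omega>) \<le> f' (X n \<omega>)"
  shows "(\<integral>\<omega>. indicator D \<omega> * f (X (Suc n) \<omega>) \<partial>M) \<le> (\<integral>\<omega>. indicator D \<omega> * f' (X n \<omega>) \<partial>M)"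
proof -
  let ?P = "bandit_step p q (\<gamma> (Suc n)) (\<gamma> (Suc n) * \<rho> (Suc n)) f"
  have P: "\<bar>?P z\<bar> \<le> K" if "z \<in> {0..1}" for z
    using p_range that gain[of "Suc n"] penalty[of "Suc n"] f(2)
    by (intro abs_bandit_step_le) (auto intro!: mult_nonneg_nonneg less_imp_le)
  have meas: "?P \<in> borel_measurable borel"
    unfolding bandit_step_def using f(1) by measurable
  have "(\<integral>\<omega>. indicator D \<omega> * f (X (Suc n) \<omega>) \<partial>M) = (\<integral>\<omega>. indicator D \<omega> * ?P (X n \<omega>) \<partial>M)"
    using step[OF D f] .
  also have "\<dots> \<le> (\<integral>\<omega>. indicator D \<omega> * f' (X n \<omega>) \<partial>M)"
    using integrable_on_event[OF sets_F_M[OF D] meas P, of n]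
          integrable_on_event[OF sets_F_M[OF D] f', of n] le
    by (intro integral_mono) (auto simp: indicator_def)
  finally show ?thesis .
qed

text \<open>
  As long as the process stays below \<open>1 - d\<close>, the mean of \<open>1 - X\<^sub>n\<close> drops in each step by at
  least a constant times \<open>\<gamma>\<^sub>n\<^sub>+\<^sub>1 \<rho>\<^sub>n\<^sub>+\<^sub>1\<close> times the probability of never returning. This mean is
  nonnegative and the products have a divergent sum, so that probability is 0. Here the
  penalty is what prevents the process from being absorbed at 0.
\<close>

lemma returns_near_1:
  assumes d: "0 < d" "d \<le> 1"
    and small: "\<And>n. n > N \<Longrightarrow> \<rho> n \<le> (p - q) * d / 4"
    and div: "filterlim (\<lambda>n. \<Sum>k=1..n. \<gamma> k * \<rho> k) at_top sequentially"
  shows "AE \<omega> in M. \<exists>n\<ge>N. 1 - d \<le> X n \<omega>"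
proof -
  define S where "S n = {\<omega> \<in> space M. \<forall>k\<in>{N..n}. X k \<omega> < 1 - d}" for n
  define S' where "S' = {\<omega> \<in> space M. \<forall>k\<in>{N..}. X k \<omega> < 1 - d}"
  have S_F: "S n \<in> sets (F n)" for n
  proof -
    have [measurable]: "X k \<in> borel_measurable (F n)" if "k \<in> {N..n}" for k
      using that by (intro X_meas_F) auto
    have "{\<omega> \<in> space (F n). \<forall>k\<in>{N..n}. X k \<omega> < 1 - d} \<in> sets (F n)"
      by measurable
    then show ?thesis by (simp add: S_def space_F)
  qed
  have S_M [measurable]: "S n \<in> sets M" for n
    using sets_F_M[OF S_F] .
  have S'_M [measurable]: "S' \<in> sets M"
    unfolding S'_def by measurable
  define c where "c = (p - q) / 4"
  have c: "c > 0" using p_range by (simp add: c_def)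
  define b where "b n = (\<integral>\<omega>. indicator (S n) \<omega> * (1 - X n \<omega>) \<partial>M)" for n
  have id_int: "integrable M (\<lambda>\<omega>. indicator D \<omega> * (1 - X n \<omega>))" if "D \<in> sets M" for D n
    using that by (intro integrable_on_event[where f = "\<lambda>z. 1 - z" and K = 1]) auto
  have dec: "b (Suc n) \<le> b n - c * (\<gamma> (Suc n) * \<rho> (Suc n)) * prob S'" if n: "N \<le> n" for n
  proof -
    let ?e = "\<gamma> (Suc n) * (\<rho> (Suc n) * c)"
    have e: "0 \<le> ?e" using c gain(1)[of "Suc n"] penalty(1)[of "Suc n"] by simp
    have "b (Suc n) \<le> (\<integral>\<omega>. indicator (S n) \<omega> * (1 - X (Suc n) \<omega>) \<partial>M)"
      unfolding b_def using X_01
      by (intro integral_mono id_int) (auto simp: indicator_def S_def)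
    also have "\<dots> \<le> (\<integral>\<omega>. indicator (S n) \<omega> * (1 - X n \<omega> - ?e) \<partial>M)"
    proof (rule step_le[OF S_F, where f = "\<lambda>z. 1 - z" and f' = "\<lambda>z. 1 - z - ?e"
          and K = 1 and K' = "1 + ?e"])
      fix \<omega> assume "\<omega> \<in> S n"
      then have "X n \<omega> \<le> 1 - d" using n by (auto simp: S_def intro!: less_imp_le)
      then have "\<rho> (Suc n) * c \<le> bandit_drift p q (\<rho> (Suc n)) (X n \<omega>)"
        unfolding c_def using p_range d small[of "Suc n"] n X_01[of n \<omega>] penalty(1)[of "Suc n"]
        by (intro bandit_drift_ge_penalty[where d = d]) auto
      then have "?e \<le> \<gamma> (Suc n) * bandit_drift p q (\<rho> (Suc n)) (X n \<omega>)"
        using gain(1)[of "Suc n"] by (intro mult_left_mono) auto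
      then show "bandit_step p q (\<gamma> (Suc n)) (\<gamma> (Suc n) * \<rho> (Suc n)) (\<lambda>z. 1 - z) (X n \<omega>)
          \<le> 1 - X n \<omega> - ?e"
        using bandit_step_affine[of p q "\<gamma> (Suc n)" "\<rho> (Suc n)" 1 "-1" "X n \<omega>"] by simp
    qed (use e in auto)
    also have "\<dots> = b n - ?e * prob (S n)"
    proof -
      have "(\<integral>\<omega>. indicator (S n) \<omega> * (1 - X n \<omega> - ?e) \<partial>M)
          = (\<integral>\<omega>. indicator (S n) \<omega> * (1 - X n \<omega>) - ?e * indicator (S n) \<omega> \<partial>M)"
        by (intro Bochner_Integration.integral_cong) (auto simp: indicator_def)
      also have "\<dots> = b n - ?e * prob (S n)"
        unfolding b_def
        by (subst Bochner_Integration.integral_diff) (auto intro!: id_int simp: integrable_event_indicator)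
      finally show ?thesis .
    qed
    also have "\<dots> \<le> b n - ?e * prob S'"
      using e by (intro diff_left_mono mult_left_mono finite_measure_mono) (auto simp: S_def S'_def)
    finally show ?thesis by (simp add: mult_ac)
  qed
  have b0: "0 \<le> b n" for n
    unfolding b_def using X_01 by (intro integral_nonneg_AE) auto
  have sum_bound: "c * prob S' * (\<Sum>k\<in>{N<..n}. \<gamma> k * \<rho> k) \<le> b N - b n" if "N \<le> n" for n
    using that
  proof (induction n rule: dec_induct)
    case base
    show ?case by simp
  next
    case (step n)
    have "{N<..Suc n} = insert (Suc n) {N<..n}" using step by auto
    then show ?case using step.IH dec[of n] step.hyps by (simp add: algebra_simps)
  qed
  have "prob S' = 0"
  proof (rule ccontr)
    assume "prob S' \<noteq> 0"
    then have cS: "c * prob S' > 0" using c by (simp add: less_le)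
    let ?s = "\<lambda>n. \<Sum>k=1..n. \<gamma> k * \<rho> k"
    have "\<forall>\<^sub>F n in sequentially. ?s n > ?s N + b N / (c * prob S')"
      using div unfolding filterlim_at_top_dense by blast
    then have "\<forall>\<^sub>F n in sequentially. n \<ge> N \<and> ?s n > ?s N + b N / (c * prob S')"
      using eventually_ge_at_top by (rule eventually_conj[rotated])
    then obtain n where n: "n \<ge> N" "?s n > ?s N + b N / (c * prob S')"
      unfolding eventually_sequentially by blast
    have "{1..n} = {1..N} \<union> {N<..n}" using n by auto
    then have "?s n = ?s N + (\<Sum>k\<in>{N<..n}. \<gamma> k * \<rho> k)"
      by (simp only:) (subst sum.union_disjoint, auto)
    with n have "b N / (c * prob S') < (\<Sum>k\<in>{N<..n}. \<gamma> k * \<rho> k)" by simp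
    then have "b N < c * prob S' * (\<Sum>k\<in>{N<..n}. \<gamma> k * \<rho> k)"
      using cS by (simp add: divide_simps mult_ac split: if_splits)
    with sum_bound[OF n(1)] b0[of n] show False by linarith
  qed
  then have "AE \<omega> in M. \<omega> \<notin> S'"
    using S'_M by (intro AE_not_in) (auto simp: emeasure_eq_measure null_sets_def)
  then show ?thesis
    by (rule AE_mp) (auto simp: S'_def not_less intro!: AE_I2)
qed

text \<open>
  Index \<open>m\<close> is the last visit to \<open>[1 - d, 1]\<close> before the process falls to \<open>1 - 2 d\<close> or below,
  without returning in between. No intermediate step occurs if a single jump leads from one
  region to the other.
\<close>

definition excursion :: "real \<Rightarrow> nat \<Rightarrow> 'a set" where
  "excursion d m = {\<omega> \<in> space M. X m \<omega> \<ge> 1 - d \<and>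
     (\<exists>n>m. (\<forall>k\<in>{m<..<n}. X k \<omega> \<in> {1 - 2 * d<..<1 - d}) \<and> X n \<omega> \<le> 1 - 2 * d)}"

lemma excursion_measurable [measurable]: "excursion d m \<in> sets M"
  unfolding excursion_def greaterThanLessThan_iff by measurable

text \<open>
  The exponential \<open>E (X\<^sub>n)\<close> with parameter \<open>l = \<theta> / \<gamma>\<^sub>m\<^sub>+\<^sub>1\<close> is a supermartingale during the
  excursion, because later gains are no larger than \<open>\<gamma>\<^sub>m\<^sub>+\<^sub>1\<close>. It starts from at most
  \<open>exp (l d + \<theta>)\<close>, where \<open>\<theta>\<close> pays for the first jump, and has to reach \<open>exp (2 l d)\<close>; the
  quotient of the two bounds the probability, as in the maximal inequality for nonnegative
  supermartingales.
\<close>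

lemma prob_excursion_le:
  assumes d: "0 < d" "d \<le> 1 / 4"
    and small: "\<And>n. n > m \<Longrightarrow> \<rho> n \<le> (p - q) * d / 4"
    and mono: "\<And>n. n > m \<Longrightarrow> \<gamma> n \<le> \<gamma> (Suc m)"
    and \<theta>: "0 \<le> \<theta>" "\<theta> \<le> (p - q) * d / 4"
  shows "prob (excursion d m) \<le> exp \<theta> * exp (- (\<theta> * d) / \<gamma> (Suc m))"
proof -
  define l where "l = \<theta> / \<gamma> (Suc m)"
  define E where "E y = exp (l * (1 - y))" for y :: real
  have g: "0 < \<gamma> (Suc m)" using gain by simp
  have l: "0 \<le> l" using g \<theta> by (simp add: l_def)
  have lg: "l * \<gamma> n \<le> \<theta>" if "n > m" for n
  proof -
    have "l * \<gamma> n \<le> l * \<gamma> (Suc m)" using l mono[OF that] by (rule mult_left_mono[rotated])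
    then show ?thesis using g by (simp add: l_def)
  qed
  have small1: "(p - q) * d / 4 \<le> 1"
    using mult_mono[of "p - q" 1 d 1] p_range d by simp
  have E_meas [measurable]: "E \<in> borel_measurable borel"
    unfolding E_def by measurable
  have E_bound: "\<bar>E z\<bar> \<le> exp l" if "z \<in> {0..1}" for z
    using that l by (auto simp: E_def intro: mult_left_le)
  have E_pos: "0 \<le> E z" for z by (simp add: E_def)
  have E_int: "integrable M (\<lambda>\<omega>. indicator D \<omega> * E (X n \<omega>))" if "D \<in> sets M" for D n
    using integrable_on_event[OF that E_meas E_bound] .
  \<comment> \<open>\<open>T n\<close>: the excursion is still under way at time \<open>n\<close>; \<open>R n\<close>: it reaches the lower level
  exactly at time \<open>n\<close>. Since \<open>T (n + 1)\<close> and \<open>R (n + 1)\<close> are disjoint parts of \<open>T n\<close>, the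
  terms for \<open>R\<close> telescope.\<close>
  define T where "T n = {\<omega> \<in> space M. 1 - d \<le> X m \<omega> \<and>
      (\<forall>k\<in>{m<..n}. X k \<omega> \<in> {1 - 2 * d<..<1 - d})}" for n
  define R where "R n = {\<omega> \<in> space M. 1 - d \<le> X m \<omega> \<and>
      (\<forall>k\<in>{m<..<n}. X k \<omega> \<in> {1 - 2 * d<..<1 - d}) \<and> X n \<omega> \<le> 1 - 2 * d}" for n
  have T_F: "T n \<in> sets (F n)" if "m \<le> n" for n
  proof -
    have [measurable]: "X m \<in> borel_measurable (F n)"
      using that by (intro X_meas_F) auto
    have "Measurable.pred (F n) (\<lambda>\<omega>. 1 - 2 * d < X k \<omega> \<and> X k \<omega> < 1 - d)" if "k \<in> {m<..n}" for k
    proof -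
      have [measurable]: "X k \<in> borel_measurable (F n)"
        using that by (intro X_meas_F) auto
      show ?thesis by measurable
    qed
    then have [measurable]:
      "Measurable.pred (F n) (\<lambda>\<omega>. \<forall>k\<in>{m<..n}. 1 - 2 * d < X k \<omega> \<and> X k \<omega> < 1 - d)"
      by (intro pred_intros_finite) auto
    have "{\<omega> \<in> space (F n). 1 - d \<le> X m \<omega> \<and>
      (\<forall>k\<in>{m<..n}. X k \<omega> \<in> {1 - 2 * d<..<1 - d})} \<in> sets (F n)"
      unfolding greaterThanLessThan_iff by measurable
    then show ?thesis by (simp add: T_def space_F)
  qed
  have T_M [measurable]: "T n \<in> sets M" for n
    unfolding T_def greaterThanLessThan_iff by measurable
  have R_M [measurable]: "R n \<in> sets M" for n
    unfolding R_def greaterThanLessThan_iff by measurable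
  define v where "v n = (\<integral>\<omega>. indicator (T n) \<omega> * E (X n \<omega>) \<partial>M)" for n
  have split: "v (Suc n) + exp (l * (2 * d)) * prob (R (Suc n))
      \<le> (\<integral>\<omega>. indicator (T n) \<omega> * E (X (Suc n) \<omega>) \<partial>M)" if n: "m \<le> n" for n
  proof -
    have "v (Suc n) + exp (l * (2 * d)) * prob (R (Suc n))
        = (\<integral>\<omega>. indicator (T (Suc n)) \<omega> * E (X (Suc n) \<omega>) +
             exp (l * (2 * d)) * indicator (R (Suc n)) \<omega> \<partial>M)"
      unfolding v_def
      by (subst Bochner_Integration.integral_add) (auto intro!: E_int simp: integrable_event_indicator)
    also have "\<dots> \<le> (\<integral>\<omega>. indicator (T n) \<omega> * E (X (Suc n) \<omega>) \<partial>M)"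
    proof (intro integral_mono E_int Bochner_Integration.integrable_add)
      fix \<omega> assume "\<omega> \<in> space M"
      have "\<omega> \<in> T (Suc n) \<Longrightarrow> \<omega> \<in> T n \<and> \<omega> \<notin> R (Suc n)"
        using n by (force simp: T_def R_def dest: bspec[of _ _ "Suc n"])
      moreover have "\<omega> \<in> R (Suc n) \<Longrightarrow> \<omega> \<in> T n \<and> exp (l * (2 * d)) \<le> E (X (Suc n) \<omega>)"
        using n l by (auto simp: T_def R_def E_def intro!: mult_left_mono)
      ultimately show "indicator (T (Suc n)) \<omega> * E (X (Suc n) \<omega>) +
          exp (l * (2 * d)) * indicator (R (Suc n)) \<omega> \<le> indicator (T n) \<omega> * E (X (Suc n) \<omega>)"
        using E_pos by (auto simp: indicator_def)
    qed (auto simp: integrable_event_indicator)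
    finally show ?thesis .
  qed
  have later: "v (Suc n) + exp (l * (2 * d)) * prob (R (Suc n)) \<le> v n" if n: "m < n" for n
  proof -
    have "(\<integral>\<omega>. indicator (T n) \<omega> * E (X (Suc n) \<omega>) \<partial>M) \<le> v n"
      unfolding v_def
    proof (rule step_le[OF T_F E_meas E_bound E_meas E_bound])
      fix \<omega> assume "\<omega> \<in> T n"
      then have X: "1 / 2 \<le> X n \<omega>" "X n \<omega> \<le> 1 - d"
        using n d by (auto simp: T_def dest!: bspec[of _ _ n])
      have "(p - q) * d / 4 \<le> bandit_drift p q (\<rho> (Suc n)) (X n \<omega>)"
        using p_range d X n small[of "Suc n"] penalty(1)[of "Suc n"]
        by (intro bandit_drift_ge_away_from_1) auto
      then show "bandit_step p q (\<gamma> (Suc n)) (\<gamma> (Suc n) * \<rho> (Suc n)) E (X n \<omega>) \<le> E (X n \<omega>)"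
        unfolding E_def
        using p_range X_01[of n \<omega>] gain[of "Suc n"] penalty(1)[of "Suc n"] small[of "Suc n"] small1
          l lg[of "Suc n"] n \<theta>
        by (intro bandit_step_exp_le) auto
    qed (use n in auto)
    with split[of n] n show ?thesis by simp
  qed
  have first: "v (Suc m) + exp (l * (2 * d)) * prob (R (Suc m)) \<le> exp (l * d + \<theta>)"
  proof -
    have "(\<integral>\<omega>. indicator (T m) \<omega> * E (X (Suc m) \<omega>) \<partial>M)
        \<le> (\<integral>\<omega>. indicator (T m) \<omega> * exp (l * d + \<theta>) \<partial>M)"
    proof (rule step_le[OF T_F E_meas E_bound])
      fix \<omega> assume "\<omega> \<in> T m"
      then have X: "1 - d \<le> X m \<omega>" by (auto simp: T_def)
      have gr: "\<gamma> (Suc m) * \<rho> (Suc m) \<le> \<gamma> (Suc m)"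
        using g small[of "Suc m"] small1 by (intro mult_left_le) auto
      have "bandit_step p q (\<gamma> (Suc m)) (\<gamma> (Suc m) * \<rho> (Suc m)) E (X m \<omega>)
          \<le> bandit_step p q (\<gamma> (Suc m)) (\<gamma> (Suc m) * \<rho> (Suc m)) (\<lambda>_. exp (l * d + \<theta>)) (X m \<omega>)"
      proof (intro bandit_step_mono)
        fix z assume "\<bar>z - X m \<omega>\<bar> \<le> max (\<gamma> (Suc m)) (\<gamma> (Suc m) * \<rho> (Suc m))"
        then have "1 - z \<le> d + \<gamma> (Suc m)" using gr X by auto
        then have "l * (1 - z) \<le> l * (d + \<gamma> (Suc m))" using l by (rule mult_left_mono)
        then show "E z \<le> exp (l * d + \<theta>)"
          using lg[of "Suc m"] by (simp add: E_def distrib_left)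
      qed (use p_range X_01[of m \<omega>] gain[of "Suc m"] penalty[of "Suc m"] in
           \<open>auto intro!: mult_nonneg_nonneg less_imp_le\<close>)
      then show "bandit_step p q (\<gamma> (Suc m)) (\<gamma> (Suc m) * \<rho> (Suc m)) E (X m \<omega>) \<le> exp (l * d + \<theta>)"
        by (simp add: bandit_step_const)
    qed auto
    also have "\<dots> = prob (T m) * exp (l * d + \<theta>)" by simp
    also have "\<dots> \<le> 1 * exp (l * d + \<theta>)" by (intro mult_right_mono prob_le_1) simp
    finally show ?thesis using split[of m] by simp
  qed
  have v0: "0 \<le> v n" for n
    unfolding v_def using E_pos by (intro integral_nonneg_AE) auto
  have total: "v (m + Suc n) + exp (l * (2 * d)) * (\<Sum>k\<le>n. prob (R (m + Suc k))) \<le> exp (l * d + \<theta>)"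
    for n
  proof (induction n)
    case 0
    then show ?case using first by simp
  next
    case (Suc n)
    then show ?case using later[of "m + Suc n"] by (simp add: algebra_simps)
  qed
  have partial: "(\<Sum>k\<le>n. prob (R (m + Suc k))) \<le> exp \<theta> * exp (- (\<theta> * d) / \<gamma> (Suc m))" for n
  proof -
    have "(\<Sum>k\<le>n. prob (R (m + Suc k))) \<le> exp (l * d + \<theta>) / exp (l * (2 * d))"
      using total[of n] v0[of "m + Suc n"] by (simp add: field_simps)
    also have "\<dots> = exp \<theta> * exp (- (\<theta> * d) / \<gamma> (Suc m))"
      unfolding exp_diff[symmetric] mult_exp_exp by (simp add: l_def algebra_simps)
    finally show ?thesis .
  qed
  have summ: "summable (\<lambda>k. prob (R (m + Suc k)))"
    using partial by (intro bounded_imp_summable) auto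
  have "excursion d m \<subseteq> (\<Union>k. R (m + Suc k))"
    unfolding excursion_def R_def by (auto dest!: less_imp_Suc_add)
  then have "prob (excursion d m) \<le> prob (\<Union>k. R (m + Suc k))"
    by (intro finite_measure_mono) auto
  also have "\<dots> \<le> (\<Sum>k. prob (R (m + Suc k)))"
    using summ by (intro finite_measure_subadditive_countably) auto
  also have "\<dots> \<le> exp \<theta> * exp (- (\<theta> * d) / \<gamma> (Suc m))"
  proof (rule LIMSEQ_le_const2[OF summable_LIMSEQ'[OF summ]])
    show "\<exists>N. \<forall>n\<ge>N. (\<Sum>k\<le>n. prob (R (m + Suc k))) \<le> exp \<theta> * exp (- (\<theta> * d) / \<gamma> (Suc m))"
      using partial by blast
  qed
  finally show ?thesis .
qed

text \<open>
  The excursion probabilities are summable, so by Borel-Cantelli only finitely many indices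
  start an excursion. Once the process returns to \<open>[1 - d, 1]\<close> after the last of them, it can
  never again fall to \<open>1 - 2 d\<close>.
\<close>

lemma eventually_near_1:
  assumes decr: "\<And>m n. 1 \<le> m \<Longrightarrow> m \<le> n \<Longrightarrow> \<gamma> n \<le> \<gamma> m"
    and summ: "\<And>\<theta>. \<theta> > 0 \<Longrightarrow> summable (\<lambda>n. exp (- \<theta> / \<gamma> (Suc n)))"
    and lim: "\<rho> \<longlonglongrightarrow> 0"
    and div: "filterlim (\<lambda>n. \<Sum>k=1..n. \<gamma> k * \<rho> k) at_top sequentially"
    and d: "0 < d" "d \<le> 1 / 4"
  shows "AE \<omega> in M. \<forall>\<^sub>F n in sequentially. 1 - 2 * d < X n \<omega>"
proof -
  let ?c = "(p - q) * d / 4"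
  have c: "0 < ?c" using p_range d by simp
  obtain N where N: "\<And>n. n \<ge> N \<Longrightarrow> \<rho> n < ?c"
    using order_tendstoD(2)[OF lim c] unfolding eventually_sequentially by blast
  have "AE \<omega> in M. \<forall>n\<in>{N..}. \<exists>k\<ge>n. 1 - d \<le> X k \<omega>"
    unfolding AE_all_countable Ball_def
    using d N by (auto simp: AE_all_countable intro!: returns_near_1[OF _ _ _ div] less_imp_le)
  moreover have "AE \<omega> in M. \<forall>\<^sub>F m in sequentially. \<omega> \<in> space M - excursion d m"
  proof (rule borel_cantelli_AE1)
    show "summable (\<lambda>m. measure M (excursion d m))"
    proof (rule summable_comparison_test_ev)
      show "summable (\<lambda>m. exp ?c * exp (- (?c * d) / \<gamma> (Suc m)))"
        using c d by (intro summable_mult summ) simp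
      show "\<forall>\<^sub>F m in sequentially.
          norm (measure M (excursion d m)) \<le> exp ?c * exp (- (?c * d) / \<gamma> (Suc m))"
        using eventually_ge_at_top[of N]
      proof eventually_elim
        case (elim m)
        show ?case
          using prob_excursion_le[of d m ?c] d c N elim decr by (simp add: less_imp_le)
      qed
    qed
  qed (auto simp: emeasure_eq_measure)
  ultimately show ?thesis
  proof eventually_elim
    case (elim \<omega>)
    obtain K where K: "\<And>m. m \<ge> K \<Longrightarrow> \<omega> \<in> space M - excursion d m"
      using elim(2) unfolding eventually_sequentially by blast
    obtain n0 where n0: "n0 \<ge> max K N" "1 - d \<le> X n0 \<omega>"
      using elim(1) by (meson atLeast_iff max.cobounded2)
    \<comment> \<open>The invariant carries along the most recent visit \<open>m\<close> to \<open>[1 - d, 1]\<close>: a fall to the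
    lower level at the next step would complete an excursion from \<open>m\<close>.\<close>
    have "1 - 2 * d < X n \<omega> \<and>
        (\<exists>m\<in>{n0..n}. 1 - d \<le> X m \<omega> \<and> (\<forall>k\<in>{m<..n}. X k \<omega> \<in> {1 - 2 * d<..<1 - d}))"
      if "n0 \<le> n" for n
      using that
    proof (induction n rule: dec_induct)
      case base
      then show ?case using n0 d by auto
    next
      case (step n)
      then obtain m where m: "n0 \<le> m" "m \<le> n" "1 - d \<le> X m \<omega>"
          "\<forall>k\<in>{m<..n}. X k \<omega> \<in> {1 - 2 * d<..<1 - d}" by auto
      have "{m<..<Suc n} = {m<..n}" by auto
      have above: "1 - 2 * d < X (Suc n) \<omega>"
      proof (rule ccontr)
        assume "\<not> 1 - 2 * d < X (Suc n) \<omega>"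
        then have "Suc n > m \<and> (\<forall>k\<in>{m<..<Suc n}. X k \<omega> \<in> {1 - 2 * d<..<1 - d}) \<and>
            X (Suc n) \<omega> \<le> 1 - 2 * d"
          unfolding \<open>{m<..<Suc n} = {m<..n}\<close> using m by (intro conjI) auto
        moreover have "\<omega> \<in> space M" "\<omega> \<notin> excursion d m"
          using K[of m] m(1) n0(1) by auto
        ultimately show False
          using m(3) unfolding excursion_def by blast
      qed
      show ?case
      proof (cases "1 - d \<le> X (Suc n) \<omega>")
        case True
        then show ?thesis using above step.hyps by (intro conjI bexI[of _ "Suc n"]) auto
      next
        case False
        then have "\<forall>k\<in>{m<..Suc n}. X k \<omega> \<in> {1 - 2 * d<..<1 - d}"
          using m(4) above by (metis greaterThanAtMost_iff greaterThanLessThan_iff le_Suc_eq not_le)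
        then show ?thesis using above m(1-3) by (intro conjI bexI[of _ m]) auto
      qed
    qed
    then show ?case unfolding eventually_sequentially by blast
  qed
qed

theorem converges_to_1:
  assumes decr: "\<And>m n. 1 \<le> m \<Longrightarrow> m \<le> n \<Longrightarrow> \<gamma> n \<le> \<gamma> m"
    and summ: "\<And>\<theta>. \<theta> > 0 \<Longrightarrow> summable (\<lambda>n. exp (- \<theta> / \<gamma> (Suc n)))"
    and lim: "\<rho> \<longlonglongrightarrow> 0"
    and div: "filterlim (\<lambda>n. \<Sum>k=1..n. \<gamma> k * \<rho> k) at_top sequentially"
  shows "AE \<omega> in M. (\<lambda>n. X n \<omega>) \<longlonglongrightarrow> 1"
proof -
  have "AE \<omega> in M. \<forall>j. \<forall>\<^sub>F n in sequentially. 1 - 2 * (inverse (real (Suc j)) / 4) < X n \<omega>"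
    unfolding AE_all_countable
    by (intro allI eventually_near_1 decr summ lim div) (auto simp: divide_simps)
  then show ?thesis
  proof eventually_elim
    case (elim \<omega>)
    show ?case
    proof (rule LIMSEQ_I)
      fix r :: real assume "0 < r"
      then obtain j where j: "inverse (real (Suc j)) < r"
        using reals_Archimedean by blast
      have "\<forall>\<^sub>F n in sequentially. norm (X n \<omega> - 1) < r"
        using spec[OF elim, of j]
      proof eventually_elim
        case (elim n)
        then show ?case using X_01(2)[of n \<omega>] j \<open>0 < r\<close> by simp
      qed
      then show "\<exists>no. \<forall>n\<ge>no. norm (X n \<omega> - 1) < r"
        unfolding eventually_sequentially .
    qed
  qed
qed

end


section \<open>Independence of generated \<open>\<sigma>\<close>-algebras\<close>

lemma (in prob_space) indep_set_commute_mono: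
  assumes indep: "indep_set S T" and sub: "S' \<subseteq> S" "T' \<subseteq> T"
  shows "indep_set T' S'"
  unfolding indep_sets2_eq
proof (intro conjI ballI)
  show "T' \<subseteq> events" "S' \<subseteq> events"
    using sub indep_setD_ev1[OF indep] indep_setD_ev2[OF indep] by auto
  fix a b assume "a \<in> T'" "b \<in> S'"
  then show "prob (a \<inter> b) = prob a * prob b"
    using indep_setD[OF indep, of b a] sub by (simp add: Int_commute mult.commute subset_iff)
qed

text \<open>
  A finite intersection over the sum of the index sets splits into two factors, one for each
  family. Independence of the generated \<open>\<sigma>\<close>-algebras separates them, and independence within
  each family expands them. This puts both families under one index set, whose subsets can
  then be regrouped freely.
\<close>

lemma (in prob_space) indep_sets_case_sum:
  fixes E :: "'i \<Rightarrow> 'a set set" and E' :: "'j \<Rightarrow> 'a set set"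
  assumes E: "indep_sets E I" and E': "indep_sets E' I'"
    and indep: "indep_set (sigma_sets (space M) (\<Union>i\<in>I. E i)) (sigma_sets (space M) (\<Union>i\<in>I'. E' i))"
  shows "indep_sets (case_sum E E') (I <+> I')"
proof -
  have sub_events: "\<And>i. i \<in> I \<Longrightarrow> E i \<subseteq> events" "\<And>i. i \<in> I' \<Longrightarrow> E' i \<subseteq> events"
    using E E' unfolding indep_sets_def by blast+
  show ?thesis
    unfolding indep_sets_def
  proof (intro conjI ballI allI impI)
    fix i assume "i \<in> I <+> I'"
    then show "case_sum E E' i \<subseteq> events"
      using sub_events by (elim PlusE) (simp_all only: sum.case)
  next
    fix J A assume J: "J \<subseteq> I <+> I'" "J \<noteq> {}" "finite J" and "A \<in> Pi J (case_sum E E')"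
    then have A: "\<And>j. j \<in> J \<Longrightarrow> A j \<in> case_sum E E' j" by auto
    define K where "K = Inl -` J"
    define K' where "K' = Inr -` J"
    have KJ: "J = Inl ` K \<union> Inr ` K'"
      using J(1) by (auto simp: K_def K'_def elim!: PlusE)
    have fin: "finite K" "finite K'"
      using J(3) by (auto simp: K_def K'_def intro: finite_vimageI)
    have sub: "K \<subseteq> I" "K' \<subseteq> I'"
      using J(1) by (auto simp: K_def K'_def)
    have AK: "A (Inl i) \<in> E i" if "i \<in> K" for i
      using A[of "Inl i"] that by (simp add: K_def)
    have AK': "A (Inr i) \<in> E' i" if "i \<in> K'" for i
      using A[of "Inr i"] that by (simp add: K'_def)
    have events: "A (Inl i) \<in> events" if "i \<in> K" for i
      using AK[OF that] sub_events(1) that sub by blast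
    have events': "A (Inr i) \<in> events" if "i \<in> K'" for i
      using AK'[OF that] sub_events(2) that sub by blast
    have prodK: "prob (\<Inter>i\<in>K. A (Inl i)) = (\<Prod>i\<in>K. prob (A (Inl i)))" if "K \<noteq> {}"
      using indep_setsD[OF E sub(1) that fin(1), of "\<lambda>i. A (Inl i)"] AK by auto
    have prodK': "prob (\<Inter>i\<in>K'. A (Inr i)) = (\<Prod>i\<in>K'. prob (A (Inr i)))" if "K' \<noteq> {}"
      using indep_setsD[OF E' sub(2) that fin(2), of "\<lambda>i. A (Inr i)"] AK' by auto
    have prod: "(\<Prod>j\<in>J. prob (A j)) = (\<Prod>i\<in>K. prob (A (Inl i))) * (\<Prod>i\<in>K'. prob (A (Inr i)))"
      unfolding KJ using fin by (subst prod.union_disjoint) (auto simp: prod.reindex)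
    have Int: "(\<Inter>j\<in>J. A j) = (\<Inter>i\<in>K. A (Inl i)) \<inter> (\<Inter>i\<in>K'. A (Inr i))"
      unfolding KJ by auto
    consider "K = {}" "K' \<noteq> {}" | "K' = {}" "K \<noteq> {}" | "K \<noteq> {}" "K' \<noteq> {}"
      using J(2) KJ by auto
    then show "prob (\<Inter>j\<in>J. A j) = (\<Prod>j\<in>J. prob (A j))"
    proof cases
      case 1
      then show ?thesis unfolding Int prod using prodK' by simp
    next
      case 2
      then show ?thesis unfolding Int prod using prodK by simp
    next
      case 3
      have s: "\<Union> (E ` I) \<subseteq> Pow (space M)" "\<Union> (E' ` I') \<subseteq> Pow (space M)"
        using sub_events sets.sets_into_space by blast+
      interpret S: sigma_algebra "space M" "sigma_sets (space M) (\<Union>i\<in>I. E i)"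
        using s(1) by (rule sigma_algebra_sigma_sets)
      interpret S': sigma_algebra "space M" "sigma_sets (space M) (\<Union>i\<in>I'. E' i)"
        using s(2) by (rule sigma_algebra_sigma_sets)
      have "(\<Inter>i\<in>K. A (Inl i)) \<in> sigma_sets (space M) (\<Union>i\<in>I. E i)"
        using 3 fin sub AK by (intro S.finite_INT) (blast intro: sigma_sets.Basic)+
      moreover have "(\<Inter>i\<in>K'. A (Inr i)) \<in> sigma_sets (space M) (\<Union>i\<in>I'. E' i)"
        using 3 fin sub AK' by (intro S'.finite_INT) (blast intro: sigma_sets.Basic)+
      ultimately show ?thesis
        unfolding Int prod using indep_setD[OF indep] prodK prodK' 3 by simp
    qed
  qed
qed

lemma (in prob_space) indep_set_collect_sigma:
  assumes E: "indep_sets E (I \<union> I')" and Int: "\<And>i. i \<in> I \<union> I' \<Longrightarrow> Int_stable (E i)"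
    and disj: "I \<inter> I' = {}"
  shows "indep_set (sigma_sets (space M) (\<Union>i\<in>I. E i)) (sigma_sets (space M) (\<Union>i\<in>I'. E i))"
proof -
  have "indep_sets (\<lambda>j. sigma_sets (space M) (\<Union>i\<in>case_bool I I' j. E i)) UNIV"
    using E Int disj
    by (intro indep_sets_collect_sigma)
       (auto simp: UNIV_bool Un_commute disjoint_family_on_def split: bool.split_asm)
  then show ?thesis
    unfolding indep_set_def
    by (rule indep_sets_mono_sets) (auto split: bool.split)
qed

lemma (in prob_space) indep_var_of_sub_sigma_algebras:
  assumes indep: "indep_set (sets F) (sets G)"
    and sp: "space F = space M" "space G = space M"
    and V: "V \<in> measurable F S" and W: "W \<in> measurable G T"
  shows "indep_var S V T W"
proof -
  have F: "sets F \<subseteq> events" "sets G \<subseteq> events"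
    using indep by (auto dest: indep_setD_ev1 indep_setD_ev2)
  have "V \<in> measurable M S" "W \<in> measurable M T"
    using V W F sp by (auto simp: measurable_def)
  moreover have "sigma_sets (space M) {V -` C \<inter> space M | C. C \<in> sets S} \<subseteq> sets F"
    unfolding sp(1)[symmetric] using measurable_sets[OF V] by (intro sets.sigma_sets_subset) auto
  moreover have "sigma_sets (space M) {W -` C \<inter> space M | C. C \<in> sets T} \<subseteq> sets G"
    unfolding sp(2)[symmetric] using measurable_sets[OF W] by (intro sets.sigma_sets_subset) auto
  ultimately show ?thesis
    using indep unfolding indep_var_eq indep_sets2_eq by blast
qed

text \<open>
  By Fubini the variable \<open>V\<close> may be integrated first, with \<open>X\<close> kept fixed, and a uniform
  variable falls below the level \<open>X\<close> with probability \<open>X\<close>.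
\<close>

lemma (in prob_space) integral_uniform_threshold:
  fixes G X V :: "'a \<Rightarrow> real"
  assumes indep: "indep_set (sets F) (sets H)"
    and sp: "space F = space M" "space H = space M"
    and G: "G \<in> borel_measurable F" and bd: "\<And>\<omega>. \<bar>G \<omega>\<bar> \<le> K"
    and X: "X \<in> borel_measurable F" "\<And>\<omega>. X \<omega> \<in> {0..1}"
    and V: "V \<in> borel_measurable H" "distr M borel V = uniform_measure lborel {0..1}"
  shows "(\<integral>\<omega>. G \<omega> * indicator {\<omega>. V \<omega> \<le> X \<omega>} \<omega> \<partial>M) = (\<integral>\<omega>. G \<omega> * X \<omega> \<partial>M)"
proof -
  let ?S = "borel \<Otimes>\<^sub>M borel :: (real \<times> real) measure"
  \<comment> \<open>The constant second component of the pair with \<open>V\<close> gives both random variables the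
  same value type, which \<open>indep_var\<close> requires.\<close>
  have iv: "indep_var ?S (\<lambda>\<omega>. (G \<omega>, X \<omega>)) ?S (\<lambda>\<omega>. (V \<omega>, 0))"
    using G X(1) V(1) by (intro indep_var_of_sub_sigma_algebras[OF indep sp]) auto
  have sub: "sets F \<subseteq> events" "sets H \<subseteq> events"
    using indep by (auto dest: indep_setD_ev1 indep_setD_ev2)
  have [measurable]: "G \<in> borel_measurable M" "X \<in> borel_measurable M" "V \<in> borel_measurable M"
    using G X(1) V(1) sub sp by (auto simp: measurable_def)
  let ?D1 = "distr M ?S (\<lambda>\<omega>. (G \<omega>, X \<omega>))" and ?D2 = "distr M ?S (\<lambda>\<omega>. (V \<omega>, 0::real))"
  interpret D1: prob_space ?D1 by (rule prob_space_distr) simp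
  interpret D2: prob_space ?D2 by (rule prob_space_distr) simp
  interpret D: pair_prob_space ?D1 ?D2 ..
  let ?f = "\<lambda>z. if fst (snd z) \<le> snd (fst z) then fst (fst z) else 0 :: real"
  have f [measurable]: "?f \<in> borel_measurable (?S \<Otimes>\<^sub>M ?S)"
    by measurable
  have joint: "?D1 \<Otimes>\<^sub>M ?D2 = distr M (?S \<Otimes>\<^sub>M ?S) (\<lambda>\<omega>. ((G \<omega>, X \<omega>), (V \<omega>, 0)))"
    using iv unfolding indep_var_distribution_eq by simp
  have K: "0 \<le> K" using bd[of undefined] by linarith
  have int: "integrable (?D1 \<Otimes>\<^sub>M ?D2) ?f"
    unfolding joint using bd K
    by (subst integrable_distr_eq) (auto intro!: integrable_const_bound[where B = K])
  have unif: "(\<integral>\<omega>. (if V \<omega> \<le> x then g else 0) \<partial>M) = g * x" if "x \<in> {0..1}" for x g :: real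
  proof -
    have "(\<integral>\<omega>. (if V \<omega> \<le> x then g else 0) \<partial>M) = (\<integral>\<omega>. g * indicator {..x} (V \<omega>) \<partial>M)"
      by (intro Bochner_Integration.integral_cong) auto
    also have "\<dots> = g * measure (distr M borel V) {..x}"
      by (subst integral_distr[symmetric, where N = borel and f = "\<lambda>v. g * indicator {..x} v"]) auto
    also have "measure (distr M borel V) {..x} = measure lborel ({0..1} \<inter> {..x}) / measure lborel {0..1::real}"
      unfolding V(2) by (subst measure_uniform_measure) auto
    also have "{0..1} \<inter> {..x} = {0..x}" using that by auto
    finally show ?thesis using that by simp
  qed
  have "(\<integral>\<omega>. G \<omega> * indicator {\<omega>. V \<omega> \<le> X \<omega>} \<omega> \<partial>M)
      = (\<integral>\<omega>. (if V \<omega> \<le> X \<omega> then G \<omega> else 0) \<partial>M)"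
    by (intro Bochner_Integration.integral_cong) auto
  also have "\<dots> = (\<integral>z. ?f z \<partial>(?D1 \<Otimes>\<^sub>M ?D2))"
    unfolding joint by (subst integral_distr) (auto cong: if_cong)
  also have "\<dots> = (\<integral>a. (\<integral>b. ?f (a, b) \<partial>?D2) \<partial>?D1)"
    using D.integral_fst'[OF int] by simp
  also have "\<dots> = (\<integral>a. (\<integral>\<omega>. (if V \<omega> \<le> snd a then fst a else 0) \<partial>M) \<partial>?D1)"
    by (intro Bochner_Integration.integral_cong refl) (subst integral_distr, auto cong: if_cong)
  also have "\<dots> = (\<integral>\<omega>. (\<integral>\<omega>'. (if V \<omega>' \<le> X \<omega> then G \<omega> else 0) \<partial>M) \<partial>M)"
    by (subst integral_distr) (auto cong: if_cong)
  also have "\<dots> = (\<integral>\<omega>. G \<omega> * X \<omega> \<partial>M)"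
    using X(2) by (simp only: unif)
  finally show ?thesis .
qed

lemma (in prob_space) integral_indep_event:
  fixes G :: "'a \<Rightarrow> real"
  assumes indep: "indep_set (sets F) (sets H)"
    and sp: "space F = space M" "space H = space M"
    and G: "G \<in> borel_measurable F" and bd: "\<And>\<omega>. \<bar>G \<omega>\<bar> \<le> K"
    and A: "A \<in> sets H"
  shows "(\<integral>\<omega>. G \<omega> * indicator A \<omega> \<partial>M) = prob A * (\<integral>\<omega>. G \<omega> \<partial>M)"
proof -
  have sub: "sets F \<subseteq> events" "sets H \<subseteq> events"
    using indep by (auto dest: indep_setD_ev1 indep_setD_ev2)
  have A': "A \<in> events" using A sub by auto
  have [measurable]: "G \<in> borel_measurable M"
    using G sub sp by (auto simp: measurable_def)
  have "integrable M G"
    using bd by (intro integrable_const_bound[where B = K]) auto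
  moreover have "integrable M (indicator A :: 'a \<Rightarrow> real)"
    using A' by (simp add: emeasure_eq_measure)
  moreover have "indep_var borel G borel (indicator A :: 'a \<Rightarrow> real)"
    using A by (intro indep_var_of_sub_sigma_algebras[OF indep sp G]) auto
  ultimately show ?thesis
    using A' by (subst indep_var_lebesgue_integral) auto
qed


section \<open>The bandit algorithm as such a chain\<close>

locale penalized_two_armed_bandit = prob_space M for M :: "'a measure" +
  fixes \<gamma> \<rho> :: "nat \<Rightarrow> real" and U :: "nat \<Rightarrow> 'a \<Rightarrow> real" and A B :: "nat \<Rightarrow> 'a set"
    and p q x :: real
  assumes p_range: "0 < q" "q < p" "p < 1"
    and gain: "\<And>n. n \<ge> 1 \<Longrightarrow> 0 < \<gamma> n" "\<And>n. n \<ge> 1 \<Longrightarrow> \<gamma> n < 1"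
    and penalty: "\<And>n. n \<ge> 1 \<Longrightarrow> 0 < \<rho> n" "\<And>n. n \<ge> 1 \<Longrightarrow> \<gamma> n * \<rho> n < 1"
    and U_indep: "indep_vars (\<lambda>_. borel) U {1..}"
    and U_uniform: "\<And>n. n \<ge> 1 \<Longrightarrow> distr M borel (U n) = uniform_measure lborel {0..1}"
    and A_event: "\<And>n. n \<ge> 1 \<Longrightarrow> A n \<in> sets M" and B_event: "\<And>n. n \<ge> 1 \<Longrightarrow> B n \<in> sets M"
    and prob_A: "\<And>n. n \<ge> 1 \<Longrightarrow> prob (A n) = p" and prob_B: "\<And>n. n \<ge> 1 \<Longrightarrow> prob (B n) = q"
    and AB_indep: "indep_vars (\<lambda>_. borel \<Otimes>\<^sub>M borel)
        (\<lambda>n \<omega>. (indicator (A n) \<omega> :: real, indicator (B n) \<omega> :: real)) {1..}"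
    and AB_U_indep: "indep_var_het
        (PiM {1..} (\<lambda>_. borel \<Otimes>\<^sub>M borel))
        (\<lambda>\<omega>. \<lambda>n\<in>{1..}. (indicator (A n) \<omega> :: real, indicator (B n) \<omega> :: real))
        (PiM {1..} (\<lambda>_. borel))
        (\<lambda>\<omega>. \<lambda>n\<in>{1..}. U n \<omega>)"
    and x_range: "0 < x" "x < 1"
begin

abbreviation X :: "nat \<Rightarrow> 'a \<Rightarrow> real" where
  "X \<equiv> penalized_bandit \<gamma> \<rho> U A B x"

definition arms :: "nat \<Rightarrow> 'a \<Rightarrow> real \<times> real" where
  "arms n \<omega> = (indicator (A n) \<omega>, indicator (B n) \<omega>)"

text \<open>
  The sources of randomness, one for each uniform variable (left summand) and one for each
  pair of arms (right summand). The two arms of one round share a source, as they may depend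
  on each other.
\<close>

definition \<E> :: "nat + nat \<Rightarrow> 'a set set" where
  "\<E> = case_sum (\<lambda>n. {U n -` C \<inter> space M | C. C \<in> sets borel})
                (\<lambda>n. {arms n -` C \<inter> space M | C. C \<in> sets (borel \<Otimes>\<^sub>M borel)})"

definition info :: "(nat + nat) set \<Rightarrow> 'a measure" where
  "info I = sigma (space M) (\<Union>i\<in>I. \<E> i)"

lemma \<E>_sub: "\<E> i \<subseteq> Pow (space M)"
  by (auto simp: \<E>_def split: sum.split)

lemma space_info [simp]: "space (info I) = space M"
  using \<E>_sub by (auto simp: info_def intro!: space_measure_of)

lemma sets_info: "sets (info I) = sigma_sets (space M) (\<Union>i\<in>I. \<E> i)"
  using \<E>_sub unfolding info_def by (intro sets_measure_of) blast

lemma sets_info_mono: "I \<subseteq> I' \<Longrightarrow> sets (info I) \<subseteq> sets (info I')"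
  unfolding sets_info by (intro sigma_sets_mono') blast

lemma indep_\<E>: "indep_sets \<E> ({1..} <+> {1..})"
  unfolding \<E>_def
proof (rule indep_sets_case_sum)
  let ?EU = "\<lambda>n. {U n -` C \<inter> space M | C. C \<in> sets borel}"
  let ?EA = "\<lambda>n. {arms n -` C \<inter> space M | C. C \<in> sets (borel \<Otimes>\<^sub>M borel)}"
  let ?PU = "PiM {1..} (\<lambda>_. borel) :: (nat \<Rightarrow> real) measure"
  let ?PA = "PiM {1..} (\<lambda>_. borel \<Otimes>\<^sub>M borel) :: (nat \<Rightarrow> real \<times> real) measure"
  show "indep_sets ?EU {1..}"
    using U_indep by (simp add: indep_vars_def2)
  show "indep_sets ?EA {1..}"
    using AB_indep unfolding indep_vars_def2 arms_def[abs_def] by blast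
  let ?SU = "sigma_sets (space M) {(\<lambda>\<omega>. \<lambda>n\<in>{1..}. U n \<omega>) -` C \<inter> space M | C. C \<in> sets ?PU}"
  let ?SA = "sigma_sets (space M) {(\<lambda>\<omega>. \<lambda>n\<in>{1..}. arms n \<omega>) -` C \<inter> space M | C. C \<in> sets ?PA}"
  have SA_SU: "indep_set ?SA ?SU"
    using AB_U_indep unfolding indep_var_het_def arms_def[abs_def] by blast
  have U: "\<Union> (?EU ` {1..}) \<subseteq> ?SU"
  proof
    fix D assume "D \<in> \<Union> (?EU ` {1..})"
    then obtain n C where n: "n \<in> {1..}" and C: "C \<in> sets borel" and D: "D = U n -` C \<inter> space M"
      by blast
    have "(\<lambda>f. f n) -` C \<inter> space ?PU \<in> sets ?PU"
      using n C by (intro measurable_sets[OF measurable_component_singleton]) auto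
    moreover have "U n -` C \<inter> space M =
        (\<lambda>\<omega>. \<lambda>n\<in>{1..}. U n \<omega>) -` ((\<lambda>f. f n) -` C \<inter> space ?PU) \<inter> space M"
      using n by (auto simp: space_PiM)
    ultimately show "D \<in> ?SU" unfolding D by (intro sigma_sets.Basic) blast
  qed
  have A: "\<Union> (?EA ` {1..}) \<subseteq> ?SA"
  proof
    fix D assume "D \<in> \<Union> (?EA ` {1..})"
    then obtain n C where n: "n \<in> {1..}" and C: "C \<in> sets (borel \<Otimes>\<^sub>M borel)"
        and D: "D = arms n -` C \<inter> space M"
      by blast
    have "(\<lambda>f. f n) -` C \<inter> space ?PA \<in> sets ?PA"
      using n C by (intro measurable_sets[OF measurable_component_singleton]) auto
    moreover have "arms n -` C \<inter> space M =
        (\<lambda>\<omega>. \<lambda>n\<in>{1..}. arms n \<omega>) -` ((\<lambda>f. f n) -` C \<inter> space ?PA) \<inter> space M"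
      using n by (auto simp: space_PiM space_pair_measure)
    ultimately show "D \<in> ?SA" unfolding D by (intro sigma_sets.Basic) blast
  qed
  show "indep_set (sigma_sets (space M) (\<Union> (?EU ` {1..}))) (sigma_sets (space M) (\<Union> (?EA ` {1..})))"
    by (rule indep_set_commute_mono[OF SA_SU sigma_sets_mono[OF A] sigma_sets_mono[OF U]])
qed

lemma indep_info:
  assumes "I \<subseteq> {1..} <+> {1..}" "I' \<subseteq> {1..} <+> {1..}" "I \<inter> I' = {}"
  shows "indep_set (sets (info I)) (sets (info I'))"
  unfolding sets_info
proof (rule indep_set_collect_sigma)
  show "indep_sets \<E> (I \<union> I')"
    using assms by (intro indep_sets_mono_index[OF _ indep_\<E>]) auto
  have stable: "Int_stable {V -` C \<inter> space M | C. C \<in> sets N}" for V :: "'a \<Rightarrow> 'c" and N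
  proof (rule Int_stableI)
    fix a b assume "a \<in> {V -` C \<inter> space M | C. C \<in> sets N}" "b \<in> {V -` C \<inter> space M | C. C \<in> sets N}"
    then obtain C C' where "C \<in> sets N" "C' \<in> sets N" "a = V -` C \<inter> space M" "b = V -` C' \<inter> space M"
      by blast
    then have "C \<inter> C' \<in> sets N" "a \<inter> b = V -` (C \<inter> C') \<inter> space M" by auto
    then show "a \<inter> b \<in> {V -` C \<inter> space M | C. C \<in> sets N}" by blast
  qed
  show "Int_stable (\<E> i)" for i
    by (cases i) (simp_all add: \<E>_def stable)
qed fact

lemma subalgebra_info:
  assumes "I \<subseteq> {1..} <+> {1..}"
  shows "subalgebra M (info I)"
  using indep_setD_ev1[OF indep_info[OF assms, of "{}"]] by (auto simp: subalgebra_def)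

lemma U_info:
  assumes "Inl n \<in> I"
  shows "U n \<in> borel_measurable (info I)"
proof (rule measurableI)
  fix C :: "real set" assume "C \<in> sets borel"
  then have "U n -` C \<inter> space M \<in> \<E> (Inl n)" by (auto simp: \<E>_def)
  then show "U n -` C \<inter> space (info I) \<in> sets (info I)"
    unfolding sets_info space_info using assms by (intro sigma_sets.Basic UN_I)
qed simp

lemma arms_info:
  assumes "Inr n \<in> I"
  shows "arms n \<in> measurable (info I) (borel \<Otimes>\<^sub>M borel)"
proof (rule measurableI)
  fix C :: "(real \<times> real) set" assume "C \<in> sets (borel \<Otimes>\<^sub>M borel)"
  then have "arms n -` C \<inter> space M \<in> \<E> (Inr n)" by (auto simp: \<E>_def)
  then show "arms n -` C \<inter> space (info I) \<in> sets (info I)"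
    unfolding sets_info space_info using assms by (intro sigma_sets.Basic UN_I)
qed (simp add: space_pair_measure)

lemma AB_info:
  assumes "n \<ge> 1" "Inr n \<in> I"
  shows "A n \<in> sets (info I)" "B n \<in> sets (info I)"
proof -
  have "{\<omega> \<in> space (info I). fst (arms n \<omega>) = 1} \<in> sets (info I)"
       "{\<omega> \<in> space (info I). snd (arms n \<omega>) = 1} \<in> sets (info I)"
    using arms_info[OF assms(2)] by measurable
  moreover have "{\<omega> \<in> space (info I). fst (arms n \<omega>) = 1} = A n"
       "{\<omega> \<in> space (info I). snd (arms n \<omega>) = 1} = B n"
    using sets.sets_into_space[OF A_event[OF assms(1)]] sets.sets_into_space[OF B_event[OF assms(1)]]
    by (auto simp: arms_def indicator_def)
  ultimately show "A n \<in> sets (info I)" "B n \<in> sets (info I)" by auto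
qed

definition \<F> :: "nat \<Rightarrow> 'a measure" where
  "\<F> n = info ({1..n} <+> {1..n})"

lemma \<F>_mono:
  assumes "m \<le> n"
  shows "subalgebra (\<F> n) (\<F> m)"
proof -
  have "{1..m} <+> {1..m} \<subseteq> {1..n} <+> {1..n}"
    using assms by (auto elim!: PlusE)
  then show ?thesis
    using sets_info_mono by (auto simp: \<F>_def subalgebra_def)
qed

lemma \<F>_sub: "subalgebra M (\<F> n)"
  unfolding \<F>_def by (rule subalgebra_info) auto

lemma X_range: "X n \<omega> \<in> {0..1}"
  using x_range gain penalty by (intro penalized_bandit_in_unit_interval) (auto intro: less_imp_le)

lemma X_Suc:
  "X (Suc n) \<omega> =
    (if U (Suc n) \<omega> \<le> X n \<omega>
     then if \<omega> \<in> A (Suc n) then X n \<omega> + \<gamma> (Suc n) * (1 - X n \<omega>)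
          else X n \<omega> - \<gamma> (Suc n) * \<rho> (Suc n) * X n \<omega>
     else if \<omega> \<in> B (Suc n) then X n \<omega> - \<gamma> (Suc n) * X n \<omega>
          else X n \<omega> + \<gamma> (Suc n) * \<rho> (Suc n) * (1 - X n \<omega>))"
  by (simp add: Let_def indicator_def)

lemma X_adapted: "X n \<in> borel_measurable (\<F> n)"
proof (induction n)
  case 0
  show ?case by simp
next
  case (Suc n)
  have [measurable]: "X n \<in> borel_measurable (\<F> (Suc n))"
    using measurable_from_subalg[OF \<F>_mono Suc] by simp
  have [measurable]: "U (Suc n) \<in> borel_measurable (\<F> (Suc n))"
    unfolding \<F>_def by (rule U_info) auto
  have [measurable]: "A (Suc n) \<in> sets (\<F> (Suc n))" "B (Suc n) \<in> sets (\<F> (Suc n))"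
    unfolding \<F>_def by (auto intro!: AB_info)
  show ?case
    unfolding X_Suc[abs_def] by measurable
qed

context
  fixes n G K
  assumes G: "G \<in> borel_measurable (\<F> n)" and bd: "\<And>\<omega>. \<bar>G \<omega> :: real\<bar> \<le> K"
begin

lemma integral_play_A:
  "(\<integral>\<omega>. G \<omega> * indicator {\<omega>. U (Suc n) \<omega> \<le> X n \<omega>} \<omega> \<partial>M) = (\<integral>\<omega>. G \<omega> * X n \<omega> \<partial>M)"
proof (rule integral_uniform_threshold[OF _ _ _ G bd X_adapted X_range])
  show "indep_set (sets (\<F> n)) (sets (info {Inl (Suc n)}))"
    unfolding \<F>_def by (rule indep_info) auto
  show "U (Suc n) \<in> borel_measurable (info {Inl (Suc n)})"
    by (rule U_info) auto
qed (auto simp: \<F>_def U_uniform)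

text \<open>
  Given the past, the arm is chosen by \<open>U\<^sub>n\<^sub>+\<^sub>1\<close> and succeeds or fails independently of the past
  and of that choice. The event \<open>C\<close> is the outcome of the round: success or failure of either
  arm.
\<close>

lemma integral_arm:
  assumes C: "C \<in> sets (info {Inr (Suc n)})"
  shows "(\<integral>\<omega>. G \<omega> * indicator {\<omega>. U (Suc n) \<omega> \<le> X n \<omega>} \<omega> * indicator C \<omega> \<partial>M) =
      prob C * (\<integral>\<omega>. G \<omega> * X n \<omega> \<partial>M)" (is ?A)
    and "(\<integral>\<omega>. G \<omega> * indicator {\<omega>. U (Suc n) \<omega> > X n \<omega>} \<omega> * indicator C \<omega> \<partial>M) =
      prob C * (\<integral>\<omega>. G \<omega> * (1 - X n \<omega>) \<partial>M)" (is ?B)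
proof -
  let ?I = "insert (Inl (Suc n)) ({1..n} <+> {1..n})"
  have K: "0 \<le> K" using bd[of undefined] by linarith
  have indep: "indep_set (sets (info ?I)) (sets (info {Inr (Suc n)}))"
    by (rule indep_info) auto
  have sub: "subalgebra (info ?I) (\<F> n)"
    using sets_info_mono[of "{1..n} <+> {1..n}" ?I] by (auto simp: \<F>_def subalgebra_def)
  have [measurable]: "G \<in> borel_measurable (info ?I)" "X n \<in> borel_measurable (info ?I)"
    using measurable_from_subalg[OF sub G] measurable_from_subalg[OF sub X_adapted] by auto
  have [measurable]: "U (Suc n) \<in> borel_measurable (info ?I)"
    by (rule U_info) auto
  have subM: "subalgebra M (info ?I)"
    by (rule subalgebra_info) auto
  have M [measurable]: "G \<in> borel_measurable M" "X n \<in> borel_measurable M" "U (Suc n) \<in> borel_measurable M"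
    by (rule measurable_from_subalg[OF subM], measurable)+
  have play_A_info: "(\<lambda>\<omega>. G \<omega> * indicator {\<omega>. U (Suc n) \<omega> \<le> X n \<omega>} \<omega>) \<in> borel_measurable (info ?I)"
    and play_B_info: "(\<lambda>\<omega>. G \<omega> * indicator {\<omega>. U (Suc n) \<omega> > X n \<omega>} \<omega>) \<in> borel_measurable (info ?I)"
    by measurable
  have "\<bar>G \<omega> * indicator S \<omega>\<bar> \<le> K" for \<omega> S
    using bd[of \<omega>] K by (auto simp: indicator_def)
  note arm = integral_indep_event[OF indep space_info space_info _ this C]
  show ?A
    unfolding arm[OF play_A_info] integral_play_A ..
  have "(\<integral>\<omega>. G \<omega> * indicator {\<omega>. U (Suc n) \<omega> > X n \<omega>} \<omega> \<partial>M) =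
      (\<integral>\<omega>. G \<omega> - G \<omega> * indicator {\<omega>. U (Suc n) \<omega> \<le> X n \<omega>} \<omega> \<partial>M)"
    by (intro Bochner_Integration.integral_cong) (auto simp: indicator_def)
  also have "\<dots> = (\<integral>\<omega>. G \<omega> \<partial>M) - (\<integral>\<omega>. G \<omega> * X n \<omega> \<partial>M)"
    unfolding integral_play_A[symmetric] using bd K
    by (intro Bochner_Integration.integral_diff integrable_const_bound[where B = K])
       (auto simp: indicator_def)
  also have "\<dots> = (\<integral>\<omega>. G \<omega> - G \<omega> * X n \<omega> \<partial>M)"
  proof (intro Bochner_Integration.integral_diff[symmetric] integrable_const_bound[where B = K])
    show "AE \<omega> in M. norm (G \<omega> * X n \<omega>) \<le> K"
    proof (rule AE_I2)
      fix \<omega>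
      have "\<bar>G \<omega>\<bar> * \<bar>X n \<omega>\<bar> \<le> K * 1"
        using bd K X_range[of n \<omega>] by (intro mult_mono) auto
      then show "norm (G \<omega> * X n \<omega>) \<le> K" by (simp add: abs_mult)
    qed
  qed (use bd in auto)
  finally have play_B: "(\<integral>\<omega>. G \<omega> * indicator {\<omega>. U (Suc n) \<omega> > X n \<omega>} \<omega> \<partial>M) =
      (\<integral>\<omega>. G \<omega> * (1 - X n \<omega>) \<partial>M)"
    by (simp add: algebra_simps)
  show ?B
    unfolding arm[OF play_B_info] play_B ..
qed

end

text \<open>
  The update is a sum of four terms, each the product of a function of the past, the choice
  of an arm, and the outcome of that arm; the preceding lemma evaluates every one of them.
\<close>

lemma markov_step:
  assumes D: "D \<in> sets (\<F> n)" and f [measurable]: "f \<in> borel_measurable borel"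
    and bd: "\<And>z. z \<in> {0..1} \<Longrightarrow> \<bar>f z\<bar> \<le> K"
  shows "(\<integral>\<omega>. indicator D \<omega> * f (X (Suc n) \<omega>) \<partial>M) =
    (\<integral>\<omega>. indicator D \<omega> *
        bandit_step p q (\<gamma> (Suc n)) (\<gamma> (Suc n) * \<rho> (Suc n)) f (X n \<omega>) \<partial>M)"
proof -
  let ?g = "\<gamma> (Suc n)" and ?h = "\<gamma> (Suc n) * \<rho> (Suc n)"
  let ?A = "A (Suc n)" and ?B = "B (Suc n)"
  let ?a = "{\<omega>. U (Suc n) \<omega> \<le> X n \<omega>}" and ?b = "{\<omega>. U (Suc n) \<omega> > X n \<omega>}"
  define G1 where "G1 \<omega> = indicator D \<omega> * f (X n \<omega> + ?g * (1 - X n \<omega>))" for \<omega>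
  define G2 where "G2 \<omega> = indicator D \<omega> * f (X n \<omega> - ?h * X n \<omega>)" for \<omega>
  define G3 where "G3 \<omega> = indicator D \<omega> * f (X n \<omega> - ?g * X n \<omega>)" for \<omega>
  define G4 where "G4 \<omega> = indicator D \<omega> * f (X n \<omega> + ?h * (1 - X n \<omega>))" for \<omega>
  note [measurable] = X_adapted[of n] D
  have meas: "G1 \<in> borel_measurable (\<F> n)" "G2 \<in> borel_measurable (\<F> n)"
    "G3 \<in> borel_measurable (\<F> n)" "G4 \<in> borel_measurable (\<F> n)"
    unfolding G1_def G2_def G3_def G4_def by measurable
  note measM [measurable] = meas[THEN measurable_from_subalg[OF \<F>_sub]]
  have K: "0 \<le> K" using bd[of 0] by simp
  have up: "y + c * (1 - y) \<in> {0..1}" and down: "y - c * y \<in> {0..1}"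
    if "0 \<le> c" "c \<le> 1" "y \<in> {0..1}" for c y :: real
  proof -
    have "0 \<le> c * (1 - y)" "c * (1 - y) \<le> 1 - y" "0 \<le> c * y" "c * y \<le> y"
      using that by (auto intro: mult_left_le_one_le)
    then show "y + c * (1 - y) \<in> {0..1}" "y - c * y \<in> {0..1}"
      using that by auto
  qed
  have gh: "0 \<le> ?g" "?g \<le> 1" "0 \<le> ?h" "?h \<le> 1"
    using gain[of "Suc n"] penalty[of "Suc n"] by (auto intro: less_imp_le mult_nonneg_nonneg)
  have bounds: "\<bar>G1 \<omega>\<bar> \<le> K" "\<bar>G2 \<omega>\<bar> \<le> K" "\<bar>G3 \<omega>\<bar> \<le> K" "\<bar>G4 \<omega>\<bar> \<le> K" for \<omega>
    unfolding G1_def G2_def G3_def G4_def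
    using K bd[OF up[OF gh(1,2) X_range]] bd[OF down[OF gh(3,4) X_range]]
      bd[OF down[OF gh(1,2) X_range]] bd[OF up[OF gh(3,4) X_range]]
    by (auto simp: indicator_def)
  have AB: "?A \<in> sets (info {Inr (Suc n)})" "?B \<in> sets (info {Inr (Suc n)})"
    by (auto intro!: AB_info)
  have AB': "space M - ?A \<in> sets (info {Inr (Suc n)})" "space M - ?B \<in> sets (info {Inr (Suc n)})"
    using sets.compl_sets[OF AB(1)] sets.compl_sets[OF AB(2)] by auto
  have probs: "prob ?A = p" "prob ?B = q" "prob (space M - ?A) = 1 - p" "prob (space M - ?B) = 1 - q"
    using A_event B_event prob_A prob_B by (auto simp: prob_compl)
  have [measurable]: "X n \<in> borel_measurable M"
    using measurable_from_subalg[OF \<F>_sub X_adapted] .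
  have [measurable]: "U (Suc n) \<in> borel_measurable M"
    using U_indep by (auto simp: indep_vars_def2)
  have [measurable]: "?A \<in> sets M" "?B \<in> sets M"
    using A_event B_event by auto
  have int: "integrable M (\<lambda>\<omega>. G \<omega> * indicator S \<omega> * indicator C \<omega>)"
    if [measurable]: "G \<in> borel_measurable M" "Measurable.pred M (\<lambda>\<omega>. \<omega> \<in> S)" "C \<in> sets M"
      and "\<And>\<omega>. \<bar>G \<omega>\<bar> \<le> K" for G :: "'a \<Rightarrow> real" and S C
    using that K by (intro integrable_const_bound[where B = K]) (auto simp: indicator_def)
  have int': "integrable M (\<lambda>\<omega>. G \<omega> * Y \<omega>)"
    if [measurable]: "G \<in> borel_measurable M" "Y \<in> borel_measurable M"
      and G: "\<And>\<omega>. \<bar>G \<omega>\<bar> \<le> K" and Y: "\<And>\<omega>. Y \<omega> \<in> {0..1}" for G Y :: "'a \<Rightarrow> real"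
  proof (rule integrable_const_bound[where B = K])
    show "AE \<omega> in M. norm (G \<omega> * Y \<omega>) \<le> K"
    proof (rule AE_I2)
      fix \<omega>
      have "\<bar>G \<omega>\<bar> * \<bar>Y \<omega>\<bar> \<le> K * 1"
        using G K Y[of \<omega>] by (intro mult_mono) auto
      then show "norm (G \<omega> * Y \<omega>) \<le> K" by (simp add: abs_mult)
    qed
  qed measurable
  have X': "1 - X n \<omega> \<in> {0..1}" for \<omega> using X_range[of n \<omega>] by auto
  have "(\<integral>\<omega>. indicator D \<omega> * f (X (Suc n) \<omega>) \<partial>M) =
    (\<integral>\<omega>. (G1 \<omega> * indicator ?a \<omega> * indicator ?A \<omega> + G2 \<omega> * indicator ?a \<omega> * indicator (space M - ?A) \<omega>)
      + (G3 \<omega> * indicator ?b \<omega> * indicator ?B \<omega> + G4 \<omega> * indicator ?b \<omega> * indicator (space M - ?B) \<omega>) \<partial>M)"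
    unfolding X_Suc G1_def G2_def G3_def G4_def
    by (intro Bochner_Integration.integral_cong) (auto simp: indicator_def)
  also have "\<dots> = (p * (\<integral>\<omega>. G1 \<omega> * X n \<omega> \<partial>M) + (1 - p) * (\<integral>\<omega>. G2 \<omega> * X n \<omega> \<partial>M))
      + (q * (\<integral>\<omega>. G3 \<omega> * (1 - X n \<omega>) \<partial>M) + (1 - q) * (\<integral>\<omega>. G4 \<omega> * (1 - X n \<omega>) \<partial>M))"
    using bounds
    by (simp add: int measM integral_arm[OF meas(1) bounds(1)] integral_arm[OF meas(2) bounds(2)]
        integral_arm[OF meas(3) bounds(3)] integral_arm[OF meas(4) bounds(4)] AB AB' probs)
  also have "\<dots> = (\<integral>\<omega>. (p * (G1 \<omega> * X n \<omega>) + (1 - p) * (G2 \<omega> * X n \<omega>))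
      + (q * (G3 \<omega> * (1 - X n \<omega>)) + (1 - q) * (G4 \<omega> * (1 - X n \<omega>))) \<partial>M)"
    using int'[OF measM(1) _ bounds(1) X_range] int'[OF measM(2) _ bounds(2) X_range]
      int'[OF measM(3) _ bounds(3) X'] int'[OF measM(4) _ bounds(4) X']
    by simp
  also have "\<dots> = (\<integral>\<omega>. indicator D \<omega> * bandit_step p q ?g ?h f (X n \<omega>) \<partial>M)"
    unfolding bandit_step_def G1_def G2_def G3_def G4_def
    by (intro Bochner_Integration.integral_cong) (auto simp: algebra_simps)
  finally show ?thesis .
qed

sublocale bandit_chain M \<F> X \<gamma> \<rho> p q
proof unfold_locales
  show "0 \<le> q" "q < p" "p \<le> 1"
    using p_range by auto
qed (rule \<F>_sub \<F>_mono X_adapted X_range gain penalty markov_step; assumption)+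

end

theorem proposition3:
  fixes M :: "'a measure"
    and \<gamma> \<rho> :: "nat \<Rightarrow> real"
    and U :: "nat \<Rightarrow> 'a \<Rightarrow> real"
    and A B :: "nat \<Rightarrow> 'a set"
    and p\<^sub>A p\<^sub>B x :: real
  assumes "prob_space M"
    and "0 < p\<^sub>B" and "p\<^sub>B \<le> p\<^sub>A" and "p\<^sub>A < 1"
    and "\<And>n. n \<ge> 1 \<Longrightarrow> 0 < \<gamma> n"
    and "\<And>n. n \<ge> 1 \<Longrightarrow> \<gamma> n < 1"
    and "\<And>m n. 1 \<le> m \<Longrightarrow> m \<le> n \<Longrightarrow> \<gamma> n \<le> \<gamma> m"
    and "filterlim (\<lambda>N. \<Sum>n=1..N. \<gamma> n) at_top sequentially"
    and "\<And>\<theta>. \<theta> > 0 \<Longrightarrow> summable (\<lambda>n. exp (- \<theta> / \<gamma> (Suc n)))"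
    and "\<And>n. n \<ge> 1 \<Longrightarrow> 0 < \<rho> n"
    and "\<And>n. n \<ge> 1 \<Longrightarrow> \<gamma> n * \<rho> n < 1"
    and "prob_space.indep_vars M (\<lambda>_. borel) U {1..}"
    and "\<And>n. n \<ge> 1 \<Longrightarrow> distr M borel (U n) = uniform_measure lborel {0..1}"
    and "\<And>n. n \<ge> 1 \<Longrightarrow> A n \<in> sets M"
    and "\<And>n. n \<ge> 1 \<Longrightarrow> B n \<in> sets M"
    and "\<And>n. n \<ge> 1 \<Longrightarrow> measure M (A n) = p\<^sub>A"
    and "\<And>n. n \<ge> 1 \<Longrightarrow> measure M (B n) = p\<^sub>B"
    and "prob_space.indep_vars M (\<lambda>_. borel \<Otimes>\<^sub>M borel)
           (\<lambda>n \<omega>. (indicator (A n) \<omega> :: real, indicator (B n) \<omega> :: real)) {1..}"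
    and "prob_space.indep_var_het M
           (PiM {1..} (\<lambda>_. borel \<Otimes>\<^sub>M borel))
           (\<lambda>\<omega>. \<lambda>n\<in>{1..}. (indicator (A n) \<omega> :: real, indicator (B n) \<omega> :: real))
           (PiM {1..} (\<lambda>_. borel))
           (\<lambda>\<omega>. \<lambda>n\<in>{1..}. U n \<omega>)"
    and "0 < x" and "x < 1"
    and "\<rho> \<longlonglongrightarrow> 0"
    and "bounded ((\<lambda>n. \<gamma> n / \<rho> n) ` {1..})"
    and "filterlim (\<lambda>N. \<Sum>n=1..N. \<gamma> n * \<rho> n) at_top sequentially"
    and "p\<^sub>A - p\<^sub>B > 0"
  shows "AE \<omega> in M. (\<lambda>n. penalized_bandit \<gamma> \<rho> U A B x n \<omega>) \<longlonglongrightarrow> 1"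
proof -
  interpret penalized_two_armed_bandit M \<gamma> \<rho> U A B p\<^sub>A p\<^sub>B x
    using assms(2,4-6,10-21,25)
    by (intro penalized_two_armed_bandit.intro penalized_two_armed_bandit_axioms.intro assms(1)) simp_all
  show ?thesis
    by (rule converges_to_1[OF assms(7,9,22,24)])
qed

end
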